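(* Every distance-biregular graph is a $2$-partitioned transmission regular graph.
   Context: All graphs are finite, simple, connected and undirected; $d(x,y)$ denotes graph distance, and $G_i(x)$ is the set of vertices at distance $i$ from $x$. A vertex $x$ of a graph $G$ has an intersection array if, for every $i$ from $0$ to the maximum distance from $x$, the numbers of neighbours of $y$ lying in $G_{i-1}(x)$ and in $G_{i+1}(x)$ are the same for all $y\in G_i(x)$; the intersection array of $x$ records these numbers. A connected graph is distance-biregular (DBR) if it is bipartite and all vertices in the same partite set have the same intersection array. A connected graph $G$ is $t$-partitioned transmission regular if there is a partition $V(G)=\bigcup_{i=1}^{t}U_i$ such that for all $i,j\in\{1,\dots,t\}$ (not necessarily distinct) the number $\sum_{y\in U_j}d(x,y)$ is the same constant $q_{ij}$ for every vertex $x\in U_i$. *)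

theory Defs
  imports "Graph_Theory.Graph_Theory" "HOL-Library.Disjoint_Sets"
begin

definition gdist :: "('a, 'b) pre_digraph \<Rightarrow> 'a \<Rightarrow> 'a \<Rightarrow> nat" where
  "gdist G x y = (LEAST n. \<exists>p. pre_digraph.awalk G x p y \<and> length p = n)"

lemma gdist_eq_\<mu>:
  assumes "wf_digraph G" and "x \<rightarrow>\<^sup>*\<^bsub>G\<^esub> y"
  shows "ereal (real (gdist G x y)) = wf_digraph.\<mu> G (\<lambda>_. 1) x y"
proof -
  interpret wf_digraph G by fact
  have cost: "awalk_cost (\<lambda>_. 1) p = real (length p)" for p
    by (induction p) auto
  have "\<exists>n p. awalk x p y \<and> length p = n"
    using assms(2) by (auto simp: reachable_awalk)
  then have "\<exists>p. awalk x p y \<and> length p = gdist G x y"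
    unfolding gdist_def by (rule LeastI_ex)
  then obtain p where p: "awalk x p y" "length p = gdist G x y"
    by blast
  have least: "gdist G x y \<le> length r" if "awalk x r y" for r
    unfolding gdist_def by (rule Least_le) (use that in blast)
  show ?thesis
  proof (rule antisym)
    show "ereal (real (gdist G x y)) \<le> \<mu> (\<lambda>_. 1) x y"
      unfolding \<mu>_def by (rule INF_greatest) (auto simp: cost least)
    show "\<mu> (\<lambda>_. 1) x y \<le> ereal (real (gdist G x y))"
      using min_cost_le_walk_cost[OF p(1), of "\<lambda>_. 1"] p(2) by (simp add: cost)
  qed
qed

definition sphere_at :: "('a, 'b) pre_digraph \<Rightarrow> 'a \<Rightarrow> nat \<Rightarrow> 'a set" where
  "sphere_at G x i = {y \<in> verts G. gdist G x y = i}"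

definition ecc :: "('a, 'b) pre_digraph \<Rightarrow> 'a \<Rightarrow> nat" where
  "ecc G x = Max (gdist G x ` verts G)"

text \<open>
  The \<open>i\<close>-th entry of the list is the pair consisting of the number of neighbours at distance
  \<open>i - 1\<close> and the number of neighbours at distance \<open>i + 1\<close> from \<open>x\<close>. The condition
  \<open>Suc (gdist G x z) = i\<close> avoids truncated subtraction: the first number is \<open>0\<close> for \<open>i = 0\<close>.
  In a finite connected graph no sphere with index at most \<open>ecc G x\<close> is empty, so a vertex has at
  most one intersection array.
\<close>

definition is_intersection_array ::
    "('a, 'b) pre_digraph \<Rightarrow> 'a \<Rightarrow> (nat \<times> nat) list \<Rightarrow> bool" where
  "is_intersection_array G x ia \<longleftrightarrow>
     length ia = Suc (ecc G x) \<and>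
     (\<forall>i\<le>ecc G x. \<forall>y\<in>sphere_at G x i.
        ia ! i = (card {z. y \<rightarrow>\<^bsub>G\<^esub> z \<and> Suc (gdist G x z) = i},
                  card {z. y \<rightarrow>\<^bsub>G\<^esub> z \<and> z \<in> sphere_at G x (Suc i)}))"

text \<open>
  Partite sets, like the parts of any partition below, are nonempty. For connected graphs this
  only excludes the one-vertex graph, which has no partition into two nonempty sets.
\<close>

definition bipartition :: "('a, 'b) pre_digraph \<Rightarrow> 'a set \<Rightarrow> 'a set \<Rightarrow> bool" where
  "bipartition G A B \<longleftrightarrow>
     A \<noteq> {} \<and> B \<noteq> {} \<and> A \<union> B = verts G \<and> A \<inter> B = {} \<and>
     (\<forall>x y. x \<rightarrow>\<^bsub>G\<^esub> y \<longrightarrow> x \<in> A \<and> y \<in> B \<or> x \<in> B \<and> y \<in> A)"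

definition distance_biregular :: "('a, 'b) pre_digraph \<Rightarrow> bool" where
  "distance_biregular G \<longleftrightarrow>
     (\<exists>A B. bipartition G A B \<and>
        (\<exists>ia. \<forall>x\<in>A. is_intersection_array G x ia) \<and>
        (\<exists>ia. \<forall>x\<in>B. is_intersection_array G x ia))"

definition partitioned_transmission_regular :: "nat \<Rightarrow> ('a, 'b) pre_digraph \<Rightarrow> bool" where
  "partitioned_transmission_regular t G \<longleftrightarrow>
     (\<exists>(U :: nat \<Rightarrow> 'a set) (q :: nat \<Rightarrow> nat \<Rightarrow> nat).
        (\<Union>i\<in>{1..t}. U i) = verts G \<and>
        disjoint_family_on U {1..t} \<and>
        (\<forall>i\<in>{1..t}. U i \<noteq> {}) \<and>
        (\<forall>i\<in>{1..t}. \<forall>j\<in>{1..t}. \<forall>x\<in>U i. (\<Sum>y\<in>U j. gdist G x y) = q i j))"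

end

theory Submission
  imports Defs
begin

text \<open>
  Counting the edges between consecutive spheres around \<open>x\<close> from both sides gives
  \<open>k\<^sub>i b\<^sub>i = k\<^bsub>i+1\<^esub> c\<^bsub>i+1\<^esub>\<close>, where \<open>k\<^sub>i\<close> is the size of the sphere of radius \<open>i\<close>, so the
  intersection array of \<open>x\<close> determines all \<open>k\<^sub>i\<close>. In a bipartite graph the spheres lie
  alternately in the two partite sets, hence the distances from \<open>x\<close> to the vertices of a
  partite set sum up to \<open>\<Sum>i k\<^sub>i\<close> with \<open>i\<close> ranging over all even or all odd radii.
\<close>

lemma (in wf_digraph) gdist_le_length:
  assumes "awalk x p y"
  shows "gdist G x y \<le> length p"
  unfolding gdist_def by (rule Least_le) (use assms in blast)

lemma (in wf_digraph) gdist_awalk: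
  assumes "x \<rightarrow>\<^sup>*\<^bsub>G\<^esub> y"
  obtains p where "awalk x p y" "length p = gdist G x y"
proof -
  have "\<exists>n p. awalk x p y \<and> length p = n"
    using assms by (auto simp: reachable_awalk)
  then have "\<exists>p. awalk x p y \<and> length p = gdist G x y"
    unfolding gdist_def by (rule LeastI_ex)
  then show thesis using that by blast
qed

lemma (in wf_digraph) gdist_self:
  assumes "x \<in> verts G"
  shows "gdist G x x = 0"
  using gdist_le_length[of x "[]" x] assms by (simp add: awalk_Nil_iff)

lemma (in wf_digraph) gdist_eq_0D:
  assumes "x \<rightarrow>\<^sup>*\<^bsub>G\<^esub> y" "gdist G x y = 0"
  shows "y = x"
  using gdist_awalk[OF assms(1)] assms(2) by (metis awalk_Nil_iff length_0_conv)

text \<open>Removing the last arc of a shortest walk to \<open>y\<close> leaves a shortest walk to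
  \<open>z\<close>, since a shorter one could be extended by the removed arc. This drives the
  inductions on the distance below.\<close>

lemma (in wf_digraph) gdist_Suc_pred:
  assumes "x \<rightarrow>\<^sup>*\<^bsub>G\<^esub> y" "gdist G x y = Suc i"
  obtains z where "z \<rightarrow>\<^bsub>G\<^esub> y" "x \<rightarrow>\<^sup>*\<^bsub>G\<^esub> z" "gdist G x z = i"
proof -
  obtain p where p: "awalk x p y" "length p = Suc i"
    using gdist_awalk assms by metis
  then obtain q e where qe: "p = q @ [e]"
    by (cases p rule: rev_cases) auto
  define z where "z = tail G e"
  have q: "awalk x q z" and e: "awalk z [e] y"
    using p(1) unfolding qe z_def by (auto simp: awalk_simps)
  have zy: "z \<rightarrow>\<^bsub>G\<^esub> y"
    using e by (auto simp: awalk_simps z_def arcs_ends_conv)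
  have xz: "x \<rightarrow>\<^sup>*\<^bsub>G\<^esub> z"
    using q by (rule reachable_awalkI)
  obtain r where r: "awalk x r z" "length r = gdist G x z"
    using gdist_awalk[OF xz] .
  have "gdist G x y \<le> length (r @ [e])"
    by (rule gdist_le_length, rule awalk_appendI[OF r(1) e])
  then have "gdist G x z = i"
    using gdist_le_length[OF q] r(2) p(2) qe assms(2) by simp
  then show thesis using that zy xz by blast
qed

text \<open>Every arc changes the side of the bipartition, so the sides alternate along a shortest
  walk.\<close>

lemma (in wf_digraph) even_gdist_iff:
  assumes "bipartition G A B" "x \<rightarrow>\<^sup>*\<^bsub>G\<^esub> y"
  shows "even (gdist G x y) \<longleftrightarrow> (x \<in> A \<longleftrightarrow> y \<in> A)"
  using assms(2)
proof (induction "gdist G x y" arbitrary: y)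
  case 0
  then show ?case by (metis gdist_eq_0D even_zero)
next
  case (Suc i)
  obtain z where z: "z \<rightarrow>\<^bsub>G\<^esub> y" "x \<rightarrow>\<^sup>*\<^bsub>G\<^esub> z" "gdist G x z = i"
    using gdist_Suc_pred Suc.prems Suc.hyps(2) by metis
  have "z \<in> A \<longleftrightarrow> y \<notin> A"
    using assms(1) z(1) unfolding bipartition_def by blast
  then show ?case
    using Suc.hyps(1)[of z] Suc.hyps(2) z by (metis even_Suc)
qed

text \<open>Stepping back along a shortest walk to \<open>y\<close> meets every smaller
  distance.\<close>

lemma (in wf_digraph) sphere_at_nonempty:
  assumes "x \<rightarrow>\<^sup>*\<^bsub>G\<^esub> y" "i \<le> gdist G x y"
  shows "sphere_at G x i \<noteq> {}"
  using assms
proof (induction "gdist G x y" arbitrary: y)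
  case 0
  then show ?case
    using reachable_in_verts(2) by (fastforce simp: sphere_at_def)
next
  case (Suc n)
  show ?case
  proof (cases "i = Suc n")
    case True
    then show ?thesis
      using Suc.hyps(2) Suc.prems(1) reachable_in_verts(2) by (fastforce simp: sphere_at_def)
  next
    case False
    then show ?thesis
      using gdist_Suc_pred[OF Suc.prems(1) Suc.hyps(2)[symmetric]] Suc.hyps Suc.prems(2)
      by (metis le_SucE)
  qed
qed

lemma (in fin_digraph) finite_sphere_at: "finite (sphere_at G x i)"
  by (simp add: sphere_at_def)

lemma (in fin_digraph) gdist_le_ecc:
  assumes "y \<in> verts G"
  shows "gdist G x y \<le> ecc G x"
  using assms by (simp add: ecc_def)

lemma (in fin_digraph) sphere_at_nonempty_le_ecc:
  assumes "strongly_connected G" "x \<in> verts G" "i \<le> ecc G x"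
  shows "sphere_at G x i \<noteq> {}"
proof -
  have "ecc G x \<in> gdist G x ` verts G"
    unfolding ecc_def using assms(2) by (intro Max_in) auto
  then obtain y where "y \<in> verts G" "ecc G x = gdist G x y"
    by auto
  then show ?thesis
    using assms by (intro sphere_at_nonempty[of x y]) auto
qed

text \<open>Double counting of the edges between two consecutive spheres. The positivity in the
  second claim allows division by \<open>fst (ia ! Suc i)\<close>, so that the size of one sphere
  yields the size of the next.\<close>

lemma (in graph) sphere_at_card_recurrence:
  assumes conn: "strongly_connected G" and x: "x \<in> verts G"
    and ia: "is_intersection_array G x ia" and i: "Suc i \<le> ecc G x"
  shows "card (sphere_at G x i) * snd (ia ! i) = card (sphere_at G x (Suc i)) * fst (ia ! Suc i)"
    and "fst (ia ! Suc i) > 0"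
proof -
  let ?S = "sphere_at G x i" and ?T = "sphere_at G x (Suc i)"
  have sym: "u \<rightarrow>\<^bsub>G\<^esub> v \<longleftrightarrow> v \<rightarrow>\<^bsub>G\<^esub> u" for u v
    using arcs_ends_symmetric[OF sym_arcs] by blast
  have b: "card {z \<in> ?T. y \<rightarrow>\<^bsub>G\<^esub> z} = snd (ia ! i)" if "y \<in> ?S" for y
  proof -
    have "{z \<in> ?T. y \<rightarrow>\<^bsub>G\<^esub> z} = {z. y \<rightarrow>\<^bsub>G\<^esub> z \<and> z \<in> ?T}"
      by blast
    then show ?thesis
      using ia i that unfolding is_intersection_array_def by simp
  qed
  have c: "card {y \<in> ?S. y \<rightarrow>\<^bsub>G\<^esub> z} = fst (ia ! Suc i)" if "z \<in> ?T" for z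
  proof -
    \<comment> \<open>The double count fixes the head \<open>z\<close> of an arc, while the array
      counts arcs leaving \<open>z\<close>; symmetry of adjacency reconciles the two.\<close>
    have "{y \<in> ?S. y \<rightarrow>\<^bsub>G\<^esub> z} = {y. z \<rightarrow>\<^bsub>G\<^esub> y \<and> Suc (gdist G x y) = Suc i}"
      using sym adj_in_verts by (auto simp: sphere_at_def)
    then show ?thesis
      using ia i that unfolding is_intersection_array_def by simp
  qed
  have "(\<Sum>y\<in>?S. card {z \<in> ?T. y \<rightarrow>\<^bsub>G\<^esub> z}) = fst (ia ! Suc i) * card ?T"
    using c by (intro sum_multicount finite_sphere_at) auto
  then show "card ?S * snd (ia ! i) = card ?T * fst (ia ! Suc i)"
    using b by (simp add: mult.commute)
  \<comment> \<open>A vertex of the outer sphere has a predecessor in the inner one, so the constant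
    number of such neighbours is not zero.\<close>
  obtain z where z: "z \<in> ?T"
    using sphere_at_nonempty_le_ecc[OF conn x i] by blast
  then have "x \<rightarrow>\<^sup>*\<^bsub>G\<^esub> z" "gdist G x z = Suc i"
    using conn x by (auto simp: sphere_at_def)
  then obtain y where "y \<rightarrow>\<^bsub>G\<^esub> z" "gdist G x y = i"
    using gdist_Suc_pred by metis
  then have "y \<in> {y \<in> ?S. y \<rightarrow>\<^bsub>G\<^esub> z}"
    using adj_in_verts by (simp add: sphere_at_def)
  then have "card {y \<in> ?S. y \<rightarrow>\<^bsub>G\<^esub> z} > 0"
    using finite_sphere_at[of x i] by (subst card_gt_0_iff) auto
  then show "fst (ia ! Suc i) > 0"
    using c[OF z] by simp
qed

lemma (in graph) card_sphere_at_eq: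
  assumes conn: "strongly_connected G" and x: "x \<in> verts G" "x' \<in> verts G"
    and ia: "is_intersection_array G x ia" "is_intersection_array G x' ia"
    and "i \<le> ecc G x"
  shows "card (sphere_at G x i) = card (sphere_at G x' i)"
  using \<open>i \<le> ecc G x\<close>
proof (induction i)
  case 0
  have "sphere_at G u 0 = {u}" if "u \<in> verts G" for u
    using that conn gdist_self gdist_eq_0D[of u] by (auto simp: sphere_at_def)
  then show ?case using x by simp
next
  case (Suc i)
  \<comment> \<open>The length of the common array fixes the eccentricity, so the recurrence is
    available at \<open>x'\<close> for the same radii.\<close>
  have "ecc G x = ecc G x'"
    using ia unfolding is_intersection_array_def by simp
  then show ?case
    using sphere_at_card_recurrence[OF conn x(1) ia(1) Suc.prems]
      sphere_at_card_recurrence(1)[OF conn x(2) ia(2), of i] Suc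
    by simp
qed

text \<open>Grouping the vertices by distance leaves a sum that depends on \<open>x\<close> only
  through its eccentricity and its sphere sizes. The truth value \<open>p\<close> selects even or
  odd radii.\<close>

lemma (in fin_digraph) sum_gdist_parity:
  "(\<Sum>y\<in>{y \<in> verts G. even (gdist G x y) = p}. gdist G x y) =
    (\<Sum>i\<le>ecc G x. if even i = p then i * card (sphere_at G x i) else 0)"
proof -
  let ?V = "{y \<in> verts G. even (gdist G x y) = p}"
  have "(\<Sum>y\<in>?V. gdist G x y) = (\<Sum>i\<le>ecc G x. \<Sum>y\<in>{y \<in> ?V. gdist G x y = i}. gdist G x y)"
    by (rule sum.group[symmetric]) (auto intro: gdist_le_ecc)
  also have "\<dots> = (\<Sum>i\<le>ecc G x. if even i = p then i * card (sphere_at G x i) else 0)"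
  proof (rule sum.cong[OF refl])
    fix i
    have "{y \<in> ?V. gdist G x y = i} = (if even i = p then sphere_at G x i else {})"
      by (auto simp: sphere_at_def)
    then show "(\<Sum>y\<in>{y \<in> ?V. gdist G x y = i}. gdist G x y) =
        (if even i = p then i * card (sphere_at G x i) else 0)"
      by (simp add: sphere_at_def)
  qed
  finally show ?thesis .
qed

lemma (in graph) sum_gdist_parity_eq:
  assumes "strongly_connected G" "x \<in> verts G" "x' \<in> verts G"
    and "is_intersection_array G x ia" "is_intersection_array G x' ia"
  shows "(\<Sum>y\<in>{y \<in> verts G. even (gdist G x y) = p}. gdist G x y) =
    (\<Sum>y\<in>{y \<in> verts G. even (gdist G x' y) = p}. gdist G x' y)"
proof -
  have "ecc G x = ecc G x'"
    using assms unfolding is_intersection_array_def by simp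
  then show ?thesis
    unfolding sum_gdist_parity using card_sphere_at_eq[OF assms] by (intro sum.cong) auto
qed

lemma bipartition_sym: "bipartition G A B \<Longrightarrow> bipartition G B A"
  unfolding bipartition_def by blast

lemma (in graph) sum_gdist_partite_eq:
  assumes conn: "strongly_connected G" and bip: "bipartition G A B"
    and ia: "\<forall>x\<in>A. is_intersection_array G x ia" and x: "x \<in> A" "x' \<in> A"
    and C: "C = A \<or> C = B"
  shows "(\<Sum>y\<in>C. gdist G x y) = (\<Sum>y\<in>C. gdist G x' y)"
proof -
  have AB: "A \<union> B = verts G" "A \<inter> B = {}"
    using bip unfolding bipartition_def by auto
  \<comment> \<open>Seen from any vertex of \<open>A\<close>, the even distances lead to
    \<open>A\<close> and the odd ones to \<open>B\<close>, so the truth value \<open>C = A\<close>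
    is the parity that cuts out \<open>C\<close>.\<close>
  have C_eq: "{y \<in> verts G. even (gdist G u y) = (C = A)} = C" if "u \<in> A" for u
  proof -
    have "u \<rightarrow>\<^sup>*\<^bsub>G\<^esub> y" if "y \<in> verts G" for y
      using conn that \<open>u \<in> A\<close> AB by auto
    then have "even (gdist G u y) \<longleftrightarrow> y \<in> A" if "y \<in> verts G" for y
      using even_gdist_iff[OF bip] that \<open>u \<in> A\<close> by blast
    then show ?thesis using C AB that by auto
  qed
  have "x \<in> verts G" "x' \<in> verts G"
    using x AB by auto
  from sum_gdist_parity_eq[OF conn this ia[rule_format, OF x(1)] ia[rule_format, OF x(2)],
      of "C = A"]
  show ?thesis
    unfolding C_eq[OF x(1)] C_eq[OF x(2)] .
qed

theorem theorem3p1: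
  fixes G :: "('a, 'b) pre_digraph"
  assumes "graph G"
    and "connected G"
    and "distance_biregular G"
  shows "partitioned_transmission_regular 2 G"
proof -
  interpret graph G by fact
  have conn: "strongly_connected G"
    using symmetric_connected_imp_strongly_connected[OF sym_arcs assms(2)] .
  obtain A B ia ib where bip: "bipartition G A B"
    and ia: "\<forall>x\<in>A. is_intersection_array G x ia"
    and ib: "\<forall>x\<in>B. is_intersection_array G x ib"
    using assms(3) unfolding distance_biregular_def by blast
  \<comment> \<open>All indices other than 1 are sent to \<open>B\<close>, so the constancy below
    can be proved for arbitrary \<open>i\<close> and \<open>j\<close> without range
    conditions.\<close>
  define U where "U = (\<lambda>i::nat. if i = 1 then A else B)"
  \<comment> \<open>The constant is read off at an arbitrarily chosen vertex of the part.\<close>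
  define q where "q = (\<lambda>i j. \<Sum>y\<in>U j. gdist G (SOME x. x \<in> U i) y)"
  have AB: "A \<union> B = verts G" "A \<inter> B = {}" "A \<noteq> {}" "B \<noteq> {}"
    using bip unfolding bipartition_def by auto
  have ivl: "{1..2::nat} = {1, 2}" by auto
  have "(\<Sum>y\<in>U j. gdist G x y) = q i j" if "x \<in> U i" for i j x
  proof -
    have s: "(SOME x. x \<in> U i) \<in> U i"
      using that by (rule someI)
    have Uj: "U j = A \<or> U j = B"
      by (simp add: U_def)
    show ?thesis
    proof (cases "i = 1")
      case True
      then have "U i = A" by (simp add: U_def)
      then show ?thesis
        using sum_gdist_partite_eq[OF conn bip ia _ _ Uj] that s unfolding q_def by metis
    next
      case False
      then have "U i = B" by (simp add: U_def)
      then show ?thesis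
        \<comment> \<open>The sides are swapped so that the part containing \<open>x\<close> comes
          first, and the alternatives in \<open>Uj\<close> are swapped to match.\<close>
        using sum_gdist_partite_eq[OF conn bipartition_sym[OF bip] ib _ _ Uj[THEN disj_commute[THEN iffD1]]]
          that s unfolding q_def by metis
    qed
  qed
  moreover have "(\<Union>i\<in>{1..2}. U i) = verts G" "disjoint_family_on U {1..2}"
    "\<forall>i\<in>{1..2}. U i \<noteq> {}"
    unfolding ivl disjoint_family_on_def U_def using AB by auto
  ultimately show ?thesis
    unfolding partitioned_transmission_regular_def by blast
qed

end
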